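(* Let $0<a<\frac13$ and let $G:\mathbb{T}^2\to\mathbb{T}^2$, $\mathbb{T}^2=\mathbb{R}^2/(2\pi\mathbb{Z})^2$, be the diffeomorphism induced by $$G(x,y)=\bigl(x+2a\sin x+a\sin y+a\sin(x-y),\; y+a\sin x+2a\sin y+a\sin(y-x)\bigr)\pmod{2\pi}.$$ Then for almost every initial condition $z\in\mathbb{T}^2$, in the sense of Lebesgue measure, the orbit $G^n(z)$ converges as $n\to+\infty$ to one of the two synchronised states $p=(\frac{2\pi}{3},\frac{4\pi}{3})$ or $p=(\frac{4\pi}{3},\frac{2\pi}{3})$, and does so exponentially fast.
   Context: Exponentially fast means: there exist $C>0$ and $\lambda\in(0,1)$ (possibly depending on $z$) with $d(G^n(z),p)\le C\lambda^n$ for all $n\ge 0$, where $d$ is the flat distance on $\mathbb{T}^2$. For $0<a<\frac13$ the map $G$ is a diffeomorphism of $\mathbb{T}^2$. *)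

theory Defs
  imports "HOL-Analysis.Analysis"
begin

definition torus_rel :: "real \<times> real \<Rightarrow> real \<times> real \<Rightarrow> bool" where
  "torus_rel u v \<longleftrightarrow>
     (\<exists>k l :: int. fst v = fst u + 2 * pi * of_int k \<and> snd v = snd u + 2 * pi * of_int l)"

lemma torus_relI:
  assumes "fst v = fst u + 2 * pi * of_int k" "snd v = snd u + 2 * pi * of_int l"
  shows "torus_rel u v"
  using assms unfolding torus_rel_def by blast

lemma torus_rel_refl: "torus_rel u u"
  by (rule torus_relI[where k = 0 and l = 0]) auto

lemma torus_rel_sym: "torus_rel u v \<Longrightarrow> torus_rel v u"
proof -
  assume "torus_rel u v"
  then obtain k l :: int where
    "fst v = fst u + 2 * pi * of_int k" "snd v = snd u + 2 * pi * of_int l"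
    unfolding torus_rel_def by blast
  then show ?thesis
    by (intro torus_relI[where k = "- k" and l = "- l"]) auto
qed

lemma torus_rel_trans:
  assumes "torus_rel u v" "torus_rel v w" shows "torus_rel u w"
proof -
  obtain k l k' l' :: int where
    "fst v = fst u + 2 * pi * of_int k" "snd v = snd u + 2 * pi * of_int l"
    "fst w = fst v + 2 * pi * of_int k'" "snd w = snd v + 2 * pi * of_int l'"
    using assms unfolding torus_rel_def by blast
  then show ?thesis
    by (intro torus_relI[where k = "k + k'" and l = "l + l'"]) (auto simp: algebra_simps)
qed

quotient_type torus = "real \<times> real" / torus_rel
  morphisms rep_torus to_torus
  by (intro equivpI reflpI sympI transpI)
     (blast intro: torus_rel_refl torus_rel_sym torus_rel_trans)+

lemma to_torus_eq_iff: "to_torus u = to_torus v \<longleftrightarrow> torus_rel u v"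
  by (simp add: torus.abs_eq_iff)

lemma to_torus_surj: "\<exists>u. p = to_torus u"
  by (metis Quotient_torus Quotient_abs_rep)

lemma torus_rel_shift:
  assumes "torus_rel v v'"
  shows "\<exists>u'. torus_rel u u' \<and> dist u' v' = dist u v"
proof -
  obtain k l :: int where
    *: "fst v' = fst v + 2 * pi * of_int k" "snd v' = snd v + 2 * pi * of_int l"
    using assms unfolding torus_rel_def by blast
  define u' where "u' = (fst u + 2 * pi * of_int k, snd u + 2 * pi * of_int l)"
  have "torus_rel u u'"
    by (rule torus_relI[of _ _ k l]) (simp_all add: u'_def)
  moreover have "dist u' v' = dist u v"
    using * by (simp add: u'_def dist_prod_def dist_real_def)
  ultimately show ?thesis by blast
qed

lemma int_dist_pos:
  fixes t :: real
  assumes "t \<notin> \<int>"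
  shows "\<exists>m>0. \<forall>k :: int. m \<le> \<bar>t - of_int k\<bar>"
proof (intro exI conjI allI)
  have "frac t > 0" using assms by (simp add: frac_gt_0_iff)
  then show "0 < min (frac t) (1 - frac t)" using frac_lt_1[of t] by simp
  fix k :: int
  show "min (frac t) (1 - frac t) \<le> \<bar>t - of_int k\<bar>"
  proof (cases "k \<le> \<lfloor>t\<rfloor>")
    case True
    then have "real_of_int k \<le> of_int \<lfloor>t\<rfloor>" by simp
    then show ?thesis by (simp add: frac_def)
  next
    case False
    then have "real_of_int (\<lfloor>t\<rfloor> + 1) \<le> of_int k" by (simp only: of_int_le_iff)
    then show ?thesis by (simp add: frac_def)
  qed
qed

lemma coord_dist_pos:
  fixes x y :: real
  assumes "\<not> (\<exists>k :: int. y = x + 2 * pi * of_int k)"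
  shows "\<exists>m>0. \<forall>i j :: int.
           m \<le> \<bar>(x + 2 * pi * of_int i) - (y + 2 * pi * of_int j)\<bar>"
proof -
  have "(x - y) / (2 * pi) \<notin> \<int>"
  proof
    assume "(x - y) / (2 * pi) \<in> \<int>"
    then obtain k :: int where "(x - y) / (2 * pi) = of_int k" by (auto elim: Ints_cases)
    then have "y = x + 2 * pi * of_int (- k)" by (simp add: field_simps)
    with assms show False by blast
  qed
  then obtain m where m: "m > 0" "\<And>k :: int. m \<le> \<bar>(x - y) / (2 * pi) - of_int k\<bar>"
    using int_dist_pos by blast
  have "2 * pi * m \<le> \<bar>(x + 2 * pi * of_int i) - (y + 2 * pi * of_int j)\<bar>" for i j :: int
  proof -
    have "2 * pi * m \<le> 2 * pi * \<bar>(x - y) / (2 * pi) - of_int (j - i)\<bar>"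
      using m(2)[of "j - i"] by simp
    also have "\<dots> = \<bar>2 * pi * ((x - y) / (2 * pi) - of_int (j - i))\<bar>"
      by (simp add: abs_mult)
    also have "2 * pi * ((x - y) / (2 * pi) - of_int (j - i))
        = (x + 2 * pi * of_int i) - (y + 2 * pi * of_int j)"
      by (simp add: field_simps)
    finally show ?thesis .
  qed
  with m(1) show ?thesis by (intro exI[of _ "2 * pi * m"]) auto
qed

lemma torus_rel_dist_pos:
  assumes "\<not> torus_rel u v"
  shows "\<exists>m>0. \<forall>u' v'. torus_rel u u' \<longrightarrow> torus_rel v v' \<longrightarrow> m \<le> dist u' v'"
proof -
  consider "\<not> (\<exists>k :: int. fst v = fst u + 2 * pi * of_int k)"
    | "\<not> (\<exists>k :: int. snd v = snd u + 2 * pi * of_int k)"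
    using assms unfolding torus_rel_def by blast
  then show ?thesis
  proof cases
    case 1
    then obtain m where m: "m > 0" "\<And>i j :: int.
        m \<le> \<bar>(fst u + 2 * pi * of_int i) - (fst v + 2 * pi * of_int j)\<bar>"
      using coord_dist_pos[OF 1] by blast
    have "m \<le> dist u' v'" if uv: "torus_rel u u'" "torus_rel v v'" for u' v'
    proof -
      have "m \<le> dist (fst u') (fst v')"
        using uv m(2) unfolding torus_rel_def dist_real_def by auto
      then show ?thesis using dist_fst_le[of u' v'] by linarith
    qed
    with m(1) show ?thesis by blast
  next
    case 2
    then obtain m where m: "m > 0" "\<And>i j :: int.
        m \<le> \<bar>(snd u + 2 * pi * of_int i) - (snd v + 2 * pi * of_int j)\<bar>"
      using coord_dist_pos[OF 2] by blast
    have "m \<le> dist u' v'" if uv: "torus_rel u u'" "torus_rel v v'" for u' v'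
    proof -
      have "m \<le> dist (snd u') (snd v')"
        using uv m(2) unfolding torus_rel_def dist_real_def by auto
      then show ?thesis using dist_snd_le[of u' v'] by linarith
    qed
    with m(1) show ?thesis by blast
  qed
qed

text \<open>The flat metric: the smallest Euclidean distance between lifts to the plane.\<close>

instantiation torus :: metric_space
begin

definition dist_torus :: "torus \<Rightarrow> torus \<Rightarrow> real" where
  "dist_torus p q = Inf {dist u v |u v. to_torus u = p \<and> to_torus v = q}"

definition uniformity_torus :: "(torus \<times> torus) filter" where
  "uniformity_torus = (INF e\<in>{0 <..}. principal {(p, q). dist p q < e})"

definition open_torus :: "torus set \<Rightarrow> bool" where
  "open_torus U = (\<forall>p\<in>U. eventually (\<lambda>(p', q). p' = p \<longrightarrow> q \<in> U) uniformity)"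

instance
proof
  have bdd: "bdd_below {dist u v |u v. to_torus u = p \<and> to_torus v = q}" for p q
    by (rule bdd_belowI[of _ 0]) auto
  have ne: "{dist u v |u v. to_torus u = p \<and> to_torus v = q} \<noteq> {}" for p q
    using to_torus_surj[of p] to_torus_surj[of q] by blast
  have le: "dist (to_torus u) (to_torus v) \<le> dist u v" for u v
    unfolding dist_torus_def by (rule cInf_lower[OF _ bdd]) blast
  have approx: "\<exists>u v. to_torus u = p \<and> to_torus v = q \<and> dist u v < dist p q + e"
    if "e > 0" for p q and e :: real
  proof -
    have "Inf {dist u v |u v. to_torus u = p \<and> to_torus v = q} < dist p q + e"
      using that by (simp add: dist_torus_def)
    from cInf_lessD[OF ne this] show ?thesis by blast
  qed
  fix p q r :: torus
  show "dist p q = 0 \<longleftrightarrow> p = q"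
  proof
    assume eq: "dist p q = 0"
    show "p = q"
    proof (rule ccontr)
      assume "p \<noteq> q"
      obtain u v where uv: "p = to_torus u" "q = to_torus v"
        using to_torus_surj by metis
      with \<open>p \<noteq> q\<close> have "\<not> torus_rel u v" by (simp add: to_torus_eq_iff)
      then obtain m where m: "m > 0"
        "\<And>u' v'. torus_rel u u' \<Longrightarrow> torus_rel v v' \<Longrightarrow> m \<le> dist u' v'"
        using torus_rel_dist_pos by blast
      obtain u' v' where "to_torus u' = p" "to_torus v' = q" "dist u' v' < m"
        using approx[OF m(1), of p q] eq by auto
      then show False using m(2)[of u' v'] uv
        by (metis to_torus_eq_iff not_less)
    qed
  next
    assume "p = q"
    obtain u where u: "p = to_torus u" using to_torus_surj by blast
    have "dist p q \<le> 0" using le[of u u] u \<open>p = q\<close> by simp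
    moreover have "0 \<le> dist p q"
      unfolding dist_torus_def by (rule cInf_greatest[OF ne]) auto
    ultimately show "dist p q = 0" by simp
  qed
  show "dist p q \<le> dist p r + dist q r"
  proof (rule field_le_epsilon)
    fix e :: real assume "e > 0"
    then have e2: "e / 2 > 0" by simp
    obtain u w where 1: "to_torus u = p" "to_torus w = r" "dist u w < dist p r + e / 2"
      using approx[OF e2] by blast
    obtain v w' where 2: "to_torus v = q" "to_torus w' = r" "dist v w' < dist q r + e / 2"
      using approx[OF e2] by blast
    have "torus_rel w' w" using 1 2 by (simp flip: to_torus_eq_iff)
    from torus_rel_shift[OF this, of v] obtain v' where
      3: "torus_rel v v'" "dist v' w = dist v w'" by blast
    have "to_torus v' = q" using 2 3 by (metis to_torus_eq_iff)
    then have "dist p q \<le> dist u v'" using le[of u v'] 1 by simp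
    also have "\<dots> \<le> dist u w + dist v' w" by (rule dist_triangle2)
    finally show "dist p q \<le> dist p r + dist q r + e" using 1 2 3 by simp
  qed
qed (simp_all add: uniformity_torus_def open_torus_def)

end

text \<open>Lebesgue measure on the torus, transported from the half-open fundamental square,
  on which \<^const>\<open>to_torus\<close> is injective.\<close>

definition fundamental_square :: "(real \<times> real) set" where
  "fundamental_square = {0..<2 * pi} \<times> {0..<2 * pi}"

lemma inj_on_to_torus: "inj_on to_torus fundamental_square"
proof (rule inj_onI)
  fix u v assume uv: "u \<in> fundamental_square" "v \<in> fundamental_square" "to_torus u = to_torus v"
  have coord: "x = y" if "0 \<le> x" "x < 2 * pi" "0 \<le> y" "y < 2 * pi" "y = x + 2 * pi * of_int k"
    for x y :: real and k :: int
  proof -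
    have "2 * pi * \<bar>of_int k :: real\<bar> = \<bar>y - x\<bar>" using that(5) by (simp add: abs_mult)
    also have "\<dots> < 2 * pi * 1" using that(1-4) by linarith
    finally have "\<bar>of_int k :: real\<bar> < 1" by simp
    then have "k = 0" by linarith
    with that(5) show ?thesis by simp
  qed
  have "torus_rel u v" using uv(3) by (simp add: to_torus_eq_iff)
  then obtain k l :: int where
    "fst v = fst u + 2 * pi * of_int k" "snd v = snd u + 2 * pi * of_int l"
    unfolding torus_rel_def by blast
  with uv(1,2) show "u = v"
    unfolding fundamental_square_def
    by (intro prod_eqI coord[of "fst u" "fst v" k] coord[of "snd u" "snd v" l]) auto
qed

definition lebesgue_torus :: "torus measure" where
  "lebesgue_torus = embed_measure (lebesgue_on fundamental_square) to_torus"

lemma AE_lebesgue_torus_iff: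
  "(AE z in lebesgue_torus. P z) \<longleftrightarrow> (AE u in lebesgue. u \<in> fundamental_square \<longrightarrow> P (to_torus u))"
proof -
  have "fundamental_square \<in> sets lebesgue"
    unfolding fundamental_square_def by (intro sets_completionI_sets) (simp add: borel_Times)
  then show ?thesis
    unfolding lebesgue_torus_def
    by (simp add: AE_embed_measure' inj_on_to_torus AE_restrict_space_iff)
qed

definition G_lift :: "real \<Rightarrow> real \<times> real \<Rightarrow> real \<times> real" where
  "G_lift a = (\<lambda>(x, y).
     (x + 2 * a * sin x + a * sin y + a * sin (x - y),
      y + a * sin x + 2 * a * sin y + a * sin (y - x)))"

lift_definition G :: "real \<Rightarrow> torus \<Rightarrow> torus" is G_lift
proof -
  fix a :: real and u v :: "real \<times> real"
  assume "torus_rel u v"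
  then obtain k l :: int where
    *: "fst v = fst u + 2 * pi * of_int k" "snd v = snd u + 2 * pi * of_int l"
    unfolding torus_rel_def by blast
  have per: "sin (x + 2 * pi * of_int m) = sin x" for x :: real and m :: int
    using sin.plus_of_int[of x m] by (simp add: mult_ac)
  have "sin (fst v - snd v) = sin (fst u - snd u + 2 * pi * of_int (k - l))"
       "sin (snd v - fst v) = sin (snd u - fst u + 2 * pi * of_int (l - k))"
    using * by (simp_all add: algebra_simps)
  then have "sin (fst v - snd v) = sin (fst u - snd u)" "sin (snd v - fst v) = sin (snd u - fst u)"
    by (simp_all only: per)
  then show "torus_rel (G_lift a u) (G_lift a v)"
    using * by (intro torus_relI[of _ _ k l]) (simp_all add: G_lift_def split_beta per)
qed

end

theory Submission
  imports Defs
begin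

text \<open>In the angles \<open>A = x\<close>, \<open>B = y - x\<close>, \<open>C = 2\<pi> - y\<close>, which sum to \<open>2\<pi>\<close>, the map is
  symmetric: \<open>A' = A + a (2 sin A - sin B - sin C)\<close> and cyclically. For \<open>A \<ge> B \<ge> C > 0\<close> it
  preserves the order, and sum-to-product formulas give
  \<open>C' - C = 2a sin (C/2) (2 cos (C/2) - cos ((A - B)/2)) \<ge> 0\<close> and
  \<open>A' - C' = (A - C) - 6a cos (B/2) sin ((A - C)/2)\<close>. Thus the smallest angle stays above its
  initial value, which keeps the orbit away from the boundary of the triangle of positive angles,
  and there the spread \<open>A - C\<close> contracts by a uniform factor. Hence the whole open triangle
  \<open>0 < x < y < 2\<pi>\<close> is attracted to its centre. Exchanging \<open>x\<close> and \<open>y\<close> covers the other triangle,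
  and the remaining lines are null.\<close>

definition angle_step :: "real \<Rightarrow> real \<Rightarrow> real \<Rightarrow> real \<Rightarrow> real" where
  "angle_step a A B C = A + a * (2 * sin A - sin B - sin C)"

text \<open>The factor comes from the lower bounds \<open>sin (c / 4)\<close> for
  \<open>cos (B / 2)\<close> and \<open>(A - C) * sin c / (2 * pi)\<close> for
  \<open>sin ((A - C) / 2)\<close> in the spread formula.\<close>

definition spread_rate :: "real \<Rightarrow> real \<Rightarrow> real" where
  "spread_rate a c = 1 - 3 * a * sin (c / 4) * sin c / pi"

text \<open>Bounding every pairwise difference makes the predicate invariant under permutations, so
  the angles may be sorted.\<close>

definition balanced :: "real \<Rightarrow> real \<Rightarrow> real \<Rightarrow> real \<Rightarrow> real \<Rightarrow> bool" where
  "balanced c D A B C \<longleftrightarrow> A + B + C = 2 * pi \<and> c \<le> A \<and> c \<le> B \<and> c \<le> C \<and>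
     \<bar>A - B\<bar> \<le> D \<and> \<bar>B - C\<bar> \<le> D \<and> \<bar>A - C\<bar> \<le> D"

lemma angle_step_commute: "angle_step a A B C = angle_step a A C B"
  by (simp add: angle_step_def)

section \<open>Sine inequalities\<close>

lemma sin_chord:
  fixes s T :: real
  assumes "0 \<le> s" "s \<le> T" "T \<le> pi"
  shows "s * sin T \<le> T * sin s"
proof (cases "T = 0")
  case False
  have "concave_on {0..pi} sin"
    by (rule f''_le0_imp_concave[where f' = cos and f'' = "\<lambda>x. - sin x"])
       (auto intro!: derivative_eq_intros sin_ge_zero)
  \<comment> \<open>Concavity puts the graph above its chord from 0 to \<open>T\<close>.\<close>
  from concave_onD[OF this, of "s / T" 0 T] show ?thesis
    using assms False by (simp add: field_simps)
qed (use assms in simp)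

lemma sin_diff_le:
  fixes u v :: real
  assumes "v \<le> u"
  shows "\<bar>sin u - sin v\<bar> \<le> u - v"
proof -
  have "\<bar>sin u - sin v\<bar> = 2 * \<bar>sin ((u - v) / 2)\<bar> * \<bar>cos ((u + v) / 2)\<bar>"
    by (simp add: sin_diff_sin abs_mult)
  also have "\<dots> \<le> 2 * \<bar>(u - v) / 2\<bar> * 1"
    by (intro mult_mono abs_sin_x_le_abs_x) auto
  finally show ?thesis using assms by simp
qed

section \<open>One step of the symmetric angle map\<close>

lemma angle_step_mono:
  assumes "0 < a" "a < 1 / 3" "B \<le> A"
  shows "angle_step a B A C \<le> angle_step a A B C"
proof -
  \<comment> \<open>The images of \<open>A\<close> and \<open>B\<close> differ by
    \<open>(A - B) + 3 * a * (sin A - sin B)\<close>; since \<open>3 * a < 1\<close> and sine is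
    1-Lipschitz, the order survives.\<close>
  have "3 * a * (sin B - sin A) \<le> 3 * a * \<bar>sin A - sin B\<bar>"
    using assms by simp
  also have "\<dots> \<le> 1 * \<bar>sin A - sin B\<bar>"
    using assms by (intro mult_right_mono) auto
  also have "\<dots> \<le> A - B" using sin_diff_le[OF assms(3)] by simp
  finally show ?thesis by (simp add: angle_step_def algebra_simps)
qed

lemma spread_rate_bounds:
  assumes "0 < a" "a < 1 / 3" "0 < c" "c \<le> 2 * pi / 3"
  shows "0 < spread_rate a c" "spread_rate a c < 1"
proof -
  have s: "0 < sin (c / 4)" "0 < sin c"
    using assms by (auto intro!: sin_gt_zero)
  have "3 * a * sin (c / 4) * sin c \<le> 1 * 1 * 1"
    using assms s by (intro mult_mono) auto
  then show "0 < spread_rate a c" using pi_gt3 by (simp add: spread_rate_def field_simps)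
  show "spread_rate a c < 1" using assms s by (simp add: spread_rate_def)
qed

lemma angle_step_smallest:
  assumes "0 < a" "A + B + C = 2 * pi" "C \<le> B" "B \<le> A" "0 < C"
  shows "C \<le> angle_step a C A B"
proof -
  have ab: "(A + B) / 2 = pi - C / 2" using assms by (simp add: field_simps)
  have "sin A + sin B = 2 * sin (C / 2) * cos ((A - B) / 2)"
    unfolding sin_plus_sin ab by simp
  moreover have "sin C = 2 * sin (C / 2) * cos (C / 2)"
    using sin_double[of "C / 2"] by simp
  ultimately have eq: "angle_step a C A B = C + 2 * a * sin (C / 2) * (2 * cos (C / 2) - cos ((A - B) / 2))"
    by (simp add: angle_step_def algebra_simps)
  \<comment> \<open>The smallest angle is at most a third of \<open>2 * pi\<close>, so
    \<open>2 * cos (C / 2)\<close> is at least 1 and dominates the other cosine.\<close>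
  have "cos (pi / 3) \<le> cos (C / 2)"
    using assms by (intro cos_monotone_0_pi_le) auto
  then have "cos ((A - B) / 2) \<le> 2 * cos (C / 2)"
    using cos_le_one[of "(A - B) / 2"] by (simp only: cos_60)
  moreover have "0 \<le> sin (C / 2)" using assms by (intro sin_ge_zero) auto
  ultimately show ?thesis unfolding eq using assms(1) by simp
qed

lemma angle_step_spread:
  assumes "0 < a" "A + B + C = 2 * pi" "C \<le> B" "B \<le> A" "0 < c" "c \<le> C"
  shows "angle_step a A B C - angle_step a C A B \<le> spread_rate a c * (A - C)"
proof -
  have ac: "(A + C) / 2 = pi - B / 2" using assms by (simp add: field_simps)
  have "angle_step a A B C - angle_step a C A B = (A - C) + 3 * a * (sin A - sin C)"
    by (simp add: angle_step_def algebra_simps)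
  also have "\<dots> = (A - C) - 6 * a * (cos (B / 2) * sin ((A - C) / 2))"
    unfolding sin_diff_sin ac by simp
  finally have eq: "angle_step a A B C - angle_step a C A B
      = (A - C) - 6 * a * (cos (B / 2) * sin ((A - C) / 2))" .
  \<comment> \<open>\<open>B \<le> A\<close> and \<open>A + B \<le> 2 * pi - c\<close> give
    \<open>B \<le> pi - c / 2\<close>.\<close>
  have "cos (pi / 2 - c / 4) \<le> cos (B / 2)"
    using assms by (intro cos_monotone_0_pi_le) auto
  then have cosB: "sin (c / 4) \<le> cos (B / 2)" by (simp add: cos_sin_eq)
  \<comment> \<open>The chord ends at \<open>pi - c\<close>, where sine equals \<open>sin c\<close>;
    it covers \<open>(A - C) / 2\<close> because \<open>A - C \<le> 2 * pi - 3 * c\<close>.\<close>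
  have "(A - C) / 2 * sin (pi - c) \<le> (pi - c) * sin ((A - C) / 2)"
    using assms by (intro sin_chord) auto
  also have "\<dots> \<le> pi * sin ((A - C) / 2)"
    using assms by (intro mult_right_mono sin_ge_zero) auto
  finally have sinV: "(A - C) * sin c / (2 * pi) \<le> sin ((A - C) / 2)"
    by (simp add: field_simps)
  have "0 \<le> sin (c / 4)" "0 \<le> sin c" using assms by (auto intro!: sin_ge_zero)
  then have "sin (c / 4) * ((A - C) * sin c / (2 * pi)) \<le> cos (B / 2) * sin ((A - C) / 2)"
    using cosB sinV assms by (intro mult_mono) auto
  then have "6 * a * (sin (c / 4) * ((A - C) * sin c / (2 * pi)))
      \<le> 6 * a * (cos (B / 2) * sin ((A - C) / 2))"
    by (rule mult_left_mono) (use assms(1) in simp)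
  moreover have "6 * a * (sin (c / 4) * ((A - C) * sin c / (2 * pi)))
      = (1 - spread_rate a c) * (A - C)"
    by (simp add: spread_rate_def field_simps)
  ultimately show ?thesis unfolding eq by (simp add: algebra_simps)
qed

lemma balanced_swap12: "balanced c D A B C \<Longrightarrow> balanced c D B A C"
  and balanced_swap23: "balanced c D A B C \<Longrightarrow> balanced c D A C B"
  by (auto simp: balanced_def abs_minus_commute)

text \<open>Since the order survives, the images of \<open>A\<close> and \<open>C\<close> remain
  extreme and control all bounds. The floor \<open>c\<close> is kept, so the same factor serves at
  every step.\<close>

lemma balanced_step_sorted:
  assumes a: "0 < a" "a < 1 / 3" and "0 < c" and bal: "balanced c D A B C"
    and ord: "C \<le> B" "B \<le> A"
  shows "balanced c (spread_rate a c * D)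
           (angle_step a A B C) (angle_step a B A C) (angle_step a C A B)"
proof -
  have *: "A + B + C = 2 * pi" "c \<le> C" "A - C \<le> D"
    using bal by (auto simp: balanced_def)
  have "c \<le> 2 * pi / 3" using * ord by simp
  then have "0 \<le> spread_rate a c" using spread_rate_bounds(1)[OF a \<open>0 < c\<close>] by simp
  then have "spread_rate a c * (A - C) \<le> spread_rate a c * D"
    using *(3) by (rule mult_left_mono[rotated])
  moreover have "angle_step a C A B \<le> angle_step a B A C"
    using angle_step_mono[OF a ord(1), of A] by (simp add: angle_step_commute)
  moreover have "angle_step a B A C \<le> angle_step a A B C"
    using angle_step_mono[OF a ord(2)] .
  moreover have "C \<le> angle_step a C A B"
    using a * ord \<open>0 < c\<close> by (intro angle_step_smallest) auto
  moreover have "angle_step a A B C - angle_step a C A B \<le> spread_rate a c * (A - C)"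
    using a * ord \<open>0 < c\<close> by (intro angle_step_spread) auto
  moreover have "angle_step a A B C + angle_step a B A C + angle_step a C A B = 2 * pi"
    using *(1) by (simp add: angle_step_def algebra_simps)
  ultimately show ?thesis using *(2) unfolding balanced_def by linarith
qed

lemma balanced_step:
  assumes "0 < a" "a < 1 / 3" "0 < c" "balanced c D A B C"
  shows "balanced c (spread_rate a c * D)
           (angle_step a A B C) (angle_step a B A C) (angle_step a C A B)"
proof -
  note sorted = balanced_step_sorted[OF assms(1-3)]
  \<comment> \<open>Each of the six orders reduces to the sorted one by transpositions, with which
    the step commutes.\<close>
  consider "C \<le> B \<and> B \<le> A" | "B \<le> C \<and> C \<le> A" | "C \<le> A \<and> A \<le> B"
    | "A \<le> C \<and> C \<le> B" | "A \<le> B \<and> B \<le> C" | "B \<le> A \<and> A \<le> C"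
    by linarith
  then show ?thesis
    using assms(4)
    by cases (metis sorted angle_step_commute balanced_swap12 balanced_swap23)+
qed

text \<open>The mean angle is \<open>2 * pi / 3\<close>, and each deviation from it is a third of a
  sum of two differences. \<open>A\<close> and \<open>C\<close> suffice to recover \<open>x\<close>
  and \<open>y\<close>.\<close>

lemma balanced_near_centre:
  assumes "balanced c D A B C"
  shows "\<bar>A - 2 * pi / 3\<bar> \<le> D" "\<bar>C - 2 * pi / 3\<bar> \<le> D"
  using assms unfolding balanced_def by linarith+

section \<open>The lift in angle coordinates and descent to the torus\<close>

definition angles_balanced :: "real \<Rightarrow> real \<Rightarrow> real \<times> real \<Rightarrow> bool" where
  "angles_balanced c D u \<longleftrightarrow> balanced c D (fst u) (snd u - fst u) (2 * pi - snd u)"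

lemma angles_balanced_G_lift:
  assumes "0 < a" "a < 1 / 3" "0 < c" "angles_balanced c D u"
  shows "angles_balanced c (spread_rate a c * D) (G_lift a u)"
proof -
  obtain x y where u: "u = (x, y)" by (cases u)
  have "sin (2 * pi - y) = - sin y" "sin (x - y) = - sin (y - x)"
    using sin_minus[of "y - x"] by (simp_all add: sin_2pi_minus)
  then have "fst (G_lift a u) = angle_step a x (y - x) (2 * pi - y)"
    "snd (G_lift a u) - fst (G_lift a u) = angle_step a (y - x) x (2 * pi - y)"
    "2 * pi - snd (G_lift a u) = angle_step a (2 * pi - y) x (y - x)"
    by (simp_all add: u G_lift_def angle_step_def algebra_simps)
  then show ?thesis
    using balanced_step[OF assms(1-3)] assms(4) by (simp add: angles_balanced_def u)
qed

lemma angles_balanced_iterate: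
  assumes "0 < a" "a < 1 / 3" "0 < c" "angles_balanced c D u"
  shows "angles_balanced c (spread_rate a c ^ n * D) ((G_lift a ^^ n) u)"
proof (induction n)
  case (Suc n)
  from angles_balanced_G_lift[OF assms(1-3) this] show ?case by (simp add: mult.assoc)
qed (use assms in simp)

text \<open>The flat distance is an infimum over lifts, so estimates in the plane pass to the
  torus.\<close>

lemma dist_to_torus_le: "dist (to_torus u) (to_torus v) \<le> dist u v"
  unfolding dist_torus_def by (rule cInf_lower) (blast, auto intro: bdd_belowI[of _ 0])

lemma G_iterate_to_torus: "(G a ^^ n) (to_torus u) = to_torus ((G_lift a ^^ n) u)"
  by (induction n) (simp_all add: G.abs_eq)

lemma G_lift_iterate_swap: "(G_lift a ^^ n) (prod.swap u) = prod.swap ((G_lift a ^^ n) u)"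
  by (induction n) (simp_all add: G_lift_def split_beta algebra_simps)

lemma dist_swap: "dist (prod.swap u) (prod.swap v) = dist u v"
  by (simp add: dist_prod_def add.commute)

lemma G_lift_converges_upper:
  assumes a: "0 < a" "a < 1 / 3" and u: "0 < fst u" "fst u < snd u" "snd u < 2 * pi"
  shows "\<exists>C>0. \<exists>r\<in>{0<..<1}. \<forall>n. dist ((G_lift a ^^ n) u) (2 * pi / 3, 4 * pi / 3) \<le> C * r ^ n"
proof -
  define c where "c = Min {fst u, snd u - fst u, 2 * pi - snd u}"
  have c: "0 < c" "c \<le> fst u" "c \<le> snd u - fst u" "c \<le> 2 * pi - snd u"
    using u by (auto simp: c_def)
  \<comment> \<open>Positive angles with sum \<open>2 * pi\<close> differ by less than
    \<open>2 * pi\<close>.\<close>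
  have init: "angles_balanced c (2 * pi) u"
    using u c by (auto simp: angles_balanced_def balanced_def)
  define r where "r = spread_rate a c"
  have r: "r \<in> {0<..<1}"
    using spread_rate_bounds[OF a c(1)] c by (simp add: r_def)
  \<comment> \<open>Each coordinate contributes at most \<open>2 * pi * r ^ n\<close>.\<close>
  have "dist ((G_lift a ^^ n) u) (2 * pi / 3, 4 * pi / 3) \<le> (4 * pi) * r ^ n" for n
  proof -
    let ?v = "(G_lift a ^^ n) u"
    have "\<bar>fst ?v - 2 * pi / 3\<bar> \<le> r ^ n * (2 * pi)" "\<bar>snd ?v - 4 * pi / 3\<bar> \<le> r ^ n * (2 * pi)"
      using balanced_near_centre[OF angles_balanced_iterate[OF a c(1) init, of n,
          unfolded angles_balanced_def]]
      by (auto simp: r_def abs_minus_commute)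
    moreover have "dist ?v (2 * pi / 3, 4 * pi / 3) \<le> \<bar>fst ?v - 2 * pi / 3\<bar> + \<bar>snd ?v - 4 * pi / 3\<bar>"
      unfolding dist_prod_def dist_real_def by (simp add: sqrt_sum_squares_le_sum_abs)
    ultimately show ?thesis by (simp add: mult.commute)
  qed
  with r show ?thesis by (intro exI[of _ "4 * pi"] conjI bexI[of _ r]) auto
qed

lemma G_lift_converges:
  assumes a: "0 < a" "a < 1 / 3"
    and u: "0 < fst u" "fst u < 2 * pi" "0 < snd u" "snd u < 2 * pi" "fst u \<noteq> snd u"
  shows "\<exists>q\<in>{(2 * pi / 3, 4 * pi / 3), (4 * pi / 3, 2 * pi / 3)}.
           \<exists>C>0. \<exists>r\<in>{0<..<1}. \<forall>n. dist ((G_lift a ^^ n) u) q \<le> C * r ^ n"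
proof (cases "fst u < snd u")
  case True
  then show ?thesis using G_lift_converges_upper[OF a u(1) _ u(4)] by blast
next
  case False
  \<comment> \<open>The target is written as a swap so that both swaps cancel in the
    distance.\<close>
  then have "\<exists>C>0. \<exists>r\<in>{0<..<1}. \<forall>n.
      dist ((G_lift a ^^ n) (prod.swap u)) (prod.swap (4 * pi / 3, 2 * pi / 3)) \<le> C * r ^ n"
    using G_lift_converges_upper[OF a, of "prod.swap u"] u by simp
  then show ?thesis unfolding G_lift_iterate_swap dist_swap by blast
qed

section \<open>Null lines and the almost everywhere statement\<close>

lemma AE_off_line:
  fixes v :: "'a::euclidean_space"
  assumes "v \<noteq> 0"
  shows "AE u in lebesgue. v \<bullet> u \<noteq> 0"
proof -
  have "{u. v \<bullet> u = 0} \<in> null_sets lebesgue"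
    using negligible_hyperplane[of v 0] assms by (simp add: negligible_iff_null_sets)
  from AE_not_in[OF this] show ?thesis by simp
qed

theorem corollary1:
  fixes a :: real
  assumes "0 < a" and "a < 1 / 3"
  shows "AE z in lebesgue_torus.
           \<exists>p \<in> {to_torus (2 * pi / 3, 4 * pi / 3), to_torus (4 * pi / 3, 2 * pi / 3)}.
             (\<lambda>n. (G a ^^ n) z) \<longlonglongrightarrow> p \<and>
             (\<exists>C > 0. \<exists>r \<in> {0<..<1}. \<forall>n. dist ((G a ^^ n) z) p \<le> C * r ^ n)"
proof -
  have step: "\<exists>p \<in> {to_torus (2 * pi / 3, 4 * pi / 3), to_torus (4 * pi / 3, 2 * pi / 3)}.
             (\<lambda>n. (G a ^^ n) (to_torus u)) \<longlonglongrightarrow> p \<and>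
             (\<exists>C > 0. \<exists>r \<in> {0<..<1}. \<forall>n. dist ((G a ^^ n) (to_torus u)) p \<le> C * r ^ n)"
    if u: "u \<in> fundamental_square" "fst u \<noteq> 0" "snd u \<noteq> 0" "fst u \<noteq> snd u" for u
  proof -
    obtain q C r where q: "q \<in> {(2 * pi / 3, 4 * pi / 3), (4 * pi / 3, 2 * pi / 3)}"
      and C: "C > 0" and r: "r \<in> {0<..<1}"
      and le: "\<And>n. dist ((G_lift a ^^ n) u) q \<le> C * r ^ n"
      using G_lift_converges[OF assms, of u] u unfolding fundamental_square_def by fastforce
    have bound: "dist ((G a ^^ n) (to_torus u)) (to_torus q) \<le> C * r ^ n" for n
      using order_trans[OF dist_to_torus_le le[of n]] by (simp add: G_iterate_to_torus)
    have "(\<lambda>n. C * r ^ n) \<longlonglongrightarrow> 0"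
      using r by (intro tendsto_mult_right_zero LIMSEQ_realpow_zero) auto
    then have "(\<lambda>n. dist ((G a ^^ n) (to_torus u)) (to_torus q)) \<longlonglongrightarrow> 0"
      by (rule Lim_null_comparison[rotated]) (simp add: bound)
    then have "(\<lambda>n. (G a ^^ n) (to_torus u)) \<longlonglongrightarrow> to_torus q"
      by (rule tendsto_dist_iff[THEN iffD2])
    with q C r bound show ?thesis by blast
  qed
  \<comment> \<open>These normals remove the edges \<open>x = 0\<close>, \<open>y = 0\<close> and
    the diagonal; the half-open square already omits the other two edges.\<close>
  have "AE u in lebesgue. (1, 0) \<bullet> (u :: real \<times> real) \<noteq> 0"
    "AE u in lebesgue. (0, 1) \<bullet> (u :: real \<times> real) \<noteq> 0"
    "AE u in lebesgue. (1, -1) \<bullet> (u :: real \<times> real) \<noteq> 0"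
    by (rule AE_off_line; simp add: zero_prod_def)+
  then show ?thesis
    unfolding AE_lebesgue_torus_iff
  proof eventually_elim
    case (elim u)
    then show ?case by (intro impI step) (auto simp: inner_prod_def)
  qed
qed

end
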